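(* Let $\mathcal V$ be a unital commutative quantale, $F,T\colon\mathsf{Set}\to\mathsf{Set}$ functors, $\zeta\colon T\circ F\Rightarrow F\circ T$ a natural transformation, and $\hat F,\hat T$ liftings of $F,T$ to $\mathcal V\text{-}\mathsf{Pred}$ with Wasserstein liftings $\bar F,\bar T$ to $\mathcal V\text{-}\mathsf{Rel}$. Assume that $\zeta$ lifts to a natural transformation $\hat\zeta\colon\hat T\circ\hat F\Rightarrow\hat F\circ\hat T$, and that for every set $X$ and every predicate $p$ on $F(X\times X)$ we have $\hat T\big((\lambda^F_X)_*(p)\big)\le (T\lambda^F_X)_*\big(\hat T(p)\big)$. Then $\zeta$ lifts to a natural transformation $\bar\zeta\colon\bar T\circ\bar F\Rightarrow\bar F\circ\bar T$.
   Context: A unital commutative quantale $\mathcal V$ is a complete lattice $(\mathcal V,\le)$ with an associative, commutative operation $\otimes$ distributing over arbitrary joins $\bigvee$, with unit $1$. $\mathcal V\text{-}\mathsf{Pred}$ has objects $p\colon X\to\mathcal V$ and morphisms $f\colon X\to Y$ from $p$ to $q$ with $p\le q\circ f$; $\mathcal V\text{-}\mathsf{Rel}$ has objects $r\colon X\times X\to\mathcal V$ and morphisms $f$ from $r$ to $q$ with $r\le q\circ(f\times f)$. For $f\colon X\to Y$ and $p\colon X\to\mathcal V$, the direct image is $f_*(p)(y)=\bigvee\{p(x)\mid f(x)=y\}$. A lifting of $F$ to $\mathcal V\text{-}\mathsf{Pred}$ is a functor sending predicates on $X$ to predicates on $FX$ and morphisms $f$ to $Ff$. The Wasserstein lifting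 of $\hat F$ sends $r\colon X\times X\to\mathcal V$ to $\bar F(r)(t_1,t_2)=\bigvee\{\hat F(r)(t)\mid t\in F(X\times X), F\pi_1(t)=t_1,F\pi_2(t)=t_2\}$ (with $r$ viewed as predicate on $X\times X$) and $f$ to $Ff$. $\lambda^F_X=\langle F\pi_1,F\pi_2\rangle\colon F(X\times X)\to FX\times FX$. A natural transformation $\zeta\colon TF\Rightarrow FT$ lifts to $\hat\zeta\colon\hat T\hat F\Rightarrow\hat F\hat T$ if $\hat T(\hat F(p))\le\hat F(\hat T(p))\circ\zeta_X$ for all predicates $p$ on any $X$; it lifts to $\bar\zeta\colon\bar T\bar F\Rightarrow\bar F\bar T$ if $\bar T(\bar F(r))\le\bar F(\bar T(r))\circ(\zeta_X\times\zeta_X)$ for all relations $r$ on any $X$. *)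

theory Defs
  imports "HOL-Library.FuncSet" "HOL-Library.Nat_Bijection"
begin

class comm_quantale = complete_lattice + comm_monoid_mult +
  assumes mult_Sup: "a * Sup A = (SUP b\<in>A. a * b)"

text \<open>
  HOL has no type of all sets, so \<open>Set\<close> is the category whose objects are the small sets of an
  arbitrary universe type and whose arrows \<open>X \<rightarrow> Y\<close> are the extensional functions
  \<^term>\<open>X \<rightarrow>\<^sub>E Y\<close>. Smallness is left abstract, because demanding all set-theoretic closure
  properties could leave HOL without any universe; only binary products are required.
  The category of all sets is the instance where the universe is a type of ZFC sets and the small
  sets are the extensions of its members.
\<close>
class set_universe =
  fixes small :: "'a set \<Rightarrow> bool"
    and pair :: "'a \<Rightarrow> 'a \<Rightarrow> 'a"
    and pfst :: "'a \<Rightarrow> 'a"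
    and psnd :: "'a \<Rightarrow> 'a"
  assumes pfst_pair [simp]: "pfst (pair x y) = x"
    and psnd_pair [simp]: "psnd (pair x y) = y"
    and small_prod: "small X \<Longrightarrow> small Y \<Longrightarrow> small (case_prod pair ` (X \<times> Y))"

lemma finite_set_universe:
  "class.set_universe finite (\<lambda>x y. prod_encode (x, y))
     (\<lambda>z. fst (prod_decode z)) (\<lambda>z. snd (prod_decode z))"
  by standard simp_all

lemma countable_set_universe:
  "class.set_universe (\<lambda>_. True) (\<lambda>x y. prod_encode (x, y))
     (\<lambda>z. fst (prod_decode z)) (\<lambda>z. snd (prod_decode z))"
  by standard simp_all

definition prd :: "'u::set_universe set \<Rightarrow> 'u set \<Rightarrow> 'u set" where
  "prd X Y = case_prod pair ` (X \<times> Y)"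

definition proj1 :: "'u::set_universe set \<Rightarrow> 'u set \<Rightarrow> 'u \<Rightarrow> 'u" where
  "proj1 X Y = (\<lambda>z\<in>prd X Y. pfst z)"

definition proj2 :: "'u::set_universe set \<Rightarrow> 'u set \<Rightarrow> 'u \<Rightarrow> 'u" where
  "proj2 X Y = (\<lambda>z\<in>prd X Y. psnd z)"

text \<open>Since arrows carry their codomain, \<open>arr F X Y f\<close> is the image of \<open>f : X \<rightarrow> Y\<close>.\<close>
record 'u endofunctor =
  obj :: "'u set \<Rightarrow> 'u set"
  arr :: "'u set \<Rightarrow> 'u set \<Rightarrow> ('u \<Rightarrow> 'u) \<Rightarrow> 'u \<Rightarrow> 'u"

definition is_functor :: "'u::set_universe endofunctor \<Rightarrow> bool" where
  "is_functor F \<longleftrightarrow>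
     (\<forall>X. small X \<longrightarrow> small (obj F X)) \<and>
     (\<forall>X Y f. small X \<longrightarrow> small Y \<longrightarrow> f \<in> X \<rightarrow>\<^sub>E Y \<longrightarrow> arr F X Y f \<in> obj F X \<rightarrow>\<^sub>E obj F Y) \<and>
     (\<forall>X. small X \<longrightarrow> arr F X X (\<lambda>x\<in>X. x) = (\<lambda>t\<in>obj F X. t)) \<and>
     (\<forall>X Y Z f g. small X \<longrightarrow> small Y \<longrightarrow> small Z \<longrightarrow> f \<in> X \<rightarrow>\<^sub>E Y \<longrightarrow> g \<in> Y \<rightarrow>\<^sub>E Z \<longrightarrow>
        arr F X Z (compose X g f) = compose (obj F X) (arr F Y Z g) (arr F X Y f))"

definition comp_functor :: "'u endofunctor \<Rightarrow> 'u endofunctor \<Rightarrow> 'u endofunctor"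
    (infixl "\<circ>\<^sub>F" 55) where
  "G \<circ>\<^sub>F F = \<lparr>obj = (\<lambda>X. obj G (obj F X)),
             arr = (\<lambda>X Y f. arr G (obj F X) (obj F Y) (arr F X Y f))\<rparr>"

definition natural_transformation ::
    "'u::set_universe endofunctor \<Rightarrow> 'u endofunctor \<Rightarrow> ('u set \<Rightarrow> 'u \<Rightarrow> 'u) \<Rightarrow> bool" where
  "natural_transformation F G \<alpha> \<longleftrightarrow>
     (\<forall>X. small X \<longrightarrow> \<alpha> X \<in> obj F X \<rightarrow>\<^sub>E obj G X) \<and>
     (\<forall>X Y f. small X \<longrightarrow> small Y \<longrightarrow> f \<in> X \<rightarrow>\<^sub>E Y \<longrightarrow>
        compose (obj F X) (\<alpha> Y) (arr F X Y f) = compose (obj F X) (arr G X Y f) (\<alpha> X))"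

definition preds :: "'u set \<Rightarrow> ('u \<Rightarrow> 'v) set" where
  "preds X = X \<rightarrow>\<^sub>E UNIV"

definition pred_mor ::
    "'u set \<Rightarrow> ('u \<Rightarrow> 'v::comm_quantale) \<Rightarrow> 'u set \<Rightarrow> ('u \<Rightarrow> 'v) \<Rightarrow> ('u \<Rightarrow> 'u) \<Rightarrow> bool" where
  "pred_mor X p Y q f \<longleftrightarrow> f \<in> X \<rightarrow>\<^sub>E Y \<and> (\<forall>x\<in>X. p x \<le> q (f x))"

text \<open>A relation \<open>X \<times> X \<rightarrow> \<V>\<close> is a predicate on the product object.\<close>
definition rels :: "'u::set_universe set \<Rightarrow> ('u \<Rightarrow> 'v) set" where
  "rels X = preds (prd X X)"

definition rel_mor ::
    "'u::set_universe set \<Rightarrow> ('u \<Rightarrow> 'v::comm_quantale) \<Rightarrow> 'u set \<Rightarrow> ('u \<Rightarrow> 'v) \<Rightarrow> ('u \<Rightarrow> 'u) \<Rightarrow> bool" where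
  "rel_mor X r Y q f \<longleftrightarrow>
     f \<in> X \<rightarrow>\<^sub>E Y \<and> (\<forall>x\<in>X. \<forall>x'\<in>X. r (pair x x') \<le> q (pair (f x) (f x')))"

definition direct_image ::
    "'u set \<Rightarrow> 'u set \<Rightarrow> ('u \<Rightarrow> 'u) \<Rightarrow> ('u \<Rightarrow> 'v::comm_quantale) \<Rightarrow> 'u \<Rightarrow> 'v" where
  "direct_image X Y f p = (\<lambda>y\<in>Y. Sup {p x | x. x \<in> X \<and> f x = y})"

text \<open>
  The lifting acts on arrows as \<open>F\<close> does, so it is given by its object part (indexed by the
  carrier \<open>X\<close>), and it inherits preservation of identities and composition from \<open>F\<close>.
\<close>
definition pred_lifting ::
    "'u::set_universe endofunctor \<Rightarrow> ('u set \<Rightarrow> ('u \<Rightarrow> 'v::comm_quantale) \<Rightarrow> 'u \<Rightarrow> 'v) \<Rightarrow> bool" where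
  "pred_lifting F Fh \<longleftrightarrow>
     (\<forall>X. small X \<longrightarrow> (\<forall>p\<in>preds X. Fh X p \<in> preds (obj F X))) \<and>
     (\<forall>X Y p q f. small X \<longrightarrow> small Y \<longrightarrow> p \<in> preds X \<longrightarrow> q \<in> preds Y \<longrightarrow> pred_mor X p Y q f \<longrightarrow>
        pred_mor (obj F X) (Fh X p) (obj F Y) (Fh Y q) (arr F X Y f))"

definition wasserstein ::
    "'u::set_universe endofunctor \<Rightarrow> ('u set \<Rightarrow> ('u \<Rightarrow> 'v::comm_quantale) \<Rightarrow> 'u \<Rightarrow> 'v)
       \<Rightarrow> 'u set \<Rightarrow> ('u \<Rightarrow> 'v) \<Rightarrow> 'u \<Rightarrow> 'v" where
  "wasserstein F Fh X r =
     (\<lambda>z\<in>prd (obj F X) (obj F X).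
        Sup {Fh (prd X X) r t | t. t \<in> obj F (prd X X) \<and>
               arr F (prd X X) X (proj1 X X) t = pfst z \<and>
               arr F (prd X X) X (proj2 X X) t = psnd z})"

definition lam :: "'u::set_universe endofunctor \<Rightarrow> 'u set \<Rightarrow> 'u \<Rightarrow> 'u" where
  "lam F X = (\<lambda>t\<in>obj F (prd X X).
     pair (arr F (prd X X) X (proj1 X X) t) (arr F (prd X X) X (proj2 X X) t))"

definition lifts_to_pred ::
    "'u::set_universe endofunctor \<Rightarrow> 'u endofunctor
       \<Rightarrow> ('u set \<Rightarrow> ('u \<Rightarrow> 'v::comm_quantale) \<Rightarrow> 'u \<Rightarrow> 'v)
       \<Rightarrow> ('u set \<Rightarrow> ('u \<Rightarrow> 'v) \<Rightarrow> 'u \<Rightarrow> 'v) \<Rightarrow> ('u set \<Rightarrow> 'u \<Rightarrow> 'u) \<Rightarrow> bool" where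
  "lifts_to_pred F T Fh Th \<zeta> \<longleftrightarrow>
     (\<forall>X. small X \<longrightarrow> (\<forall>p\<in>preds X.
        pred_mor (obj T (obj F X)) (Th (obj F X) (Fh X p))
                 (obj F (obj T X)) (Fh (obj T X) (Th X p)) (\<zeta> X)))"

definition lifts_to_rel ::
    "'u::set_universe endofunctor \<Rightarrow> 'u endofunctor
       \<Rightarrow> ('u set \<Rightarrow> ('u \<Rightarrow> 'v::comm_quantale) \<Rightarrow> 'u \<Rightarrow> 'v)
       \<Rightarrow> ('u set \<Rightarrow> ('u \<Rightarrow> 'v) \<Rightarrow> 'u \<Rightarrow> 'v) \<Rightarrow> ('u set \<Rightarrow> 'u \<Rightarrow> 'u) \<Rightarrow> bool" where
  "lifts_to_rel F T Fb Tb \<zeta> \<longleftrightarrow>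
     (\<forall>X. small X \<longrightarrow> (\<forall>r\<in>rels X.
        rel_mor (obj T (obj F X)) (Tb (obj F X) (Fb X r))
                (obj F (obj T X)) (Fb (obj T X) (Tb X r)) (\<zeta> X)))"

end

theory Submission
  imports Defs
begin

text \<open>
  The Wasserstein lifting is the direct image of \<open>Fh\<close> along \<open>\<lambda>\<^sup>F = lam F X\<close>, so by the last
  hypothesis the value of \<open>Th\<close> at a coupling \<open>s\<close> in \<open>T (FX \<times> FX)\<close> is at most the join of its
  values at the elements \<open>w\<close> of \<open>T (F (X \<times> X))\<close> over \<open>s\<close>. The element \<open>F \<lambda>\<^sup>T (\<zeta> w)\<close> of
  \<open>F (TX \<times> TX)\<close> has the marginals \<open>\<zeta> (T \<pi>\<^sub>i s)\<close>, by naturality of \<open>\<zeta>\<close> at \<open>\<pi>\<^sub>i\<close> and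
  \<open>\<pi>\<^sub>i \<circ> \<lambda>\<^sup>G = G \<pi>\<^sub>i\<close>, and its value is at least that of \<open>w\<close>.
\<close>

lemma small_prd: "small X \<Longrightarrow> small Y \<Longrightarrow> small (prd X Y)"
  unfolding prd_def by (rule small_prod)

lemma pair_in_prd: "x \<in> X \<Longrightarrow> y \<in> Y \<Longrightarrow> pair x y \<in> prd X Y"
  unfolding prd_def by force

lemma proj1_pair: "x \<in> X \<Longrightarrow> y \<in> Y \<Longrightarrow> proj1 X Y (pair x y) = x"
  by (simp add: proj1_def pair_in_prd)

lemma proj2_pair: "x \<in> X \<Longrightarrow> y \<in> Y \<Longrightarrow> proj2 X Y (pair x y) = y"
  by (simp add: proj2_def pair_in_prd)

lemma proj1_funcset: "proj1 X Y \<in> prd X Y \<rightarrow>\<^sub>E X"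
  by (auto simp: proj1_def prd_def)

lemma proj2_funcset: "proj2 X Y \<in> prd X Y \<rightarrow>\<^sub>E Y"
  by (auto simp: proj2_def prd_def)

lemma functor_small: "is_functor F \<Longrightarrow> small X \<Longrightarrow> small (obj F X)"
  by (simp add: is_functor_def)

lemma functor_arr:
  "is_functor F \<Longrightarrow> small X \<Longrightarrow> small Y \<Longrightarrow> f \<in> X \<rightarrow>\<^sub>E Y \<Longrightarrow> arr F X Y f \<in> obj F X \<rightarrow>\<^sub>E obj F Y"
  by (simp add: is_functor_def)

lemma functor_arr_comp:
  assumes "is_functor F" "small X" "small Y" "small Z" "f \<in> X \<rightarrow>\<^sub>E Y" "g \<in> Y \<rightarrow>\<^sub>E Z" "t \<in> obj F X"
  shows "arr F Y Z g (arr F X Y f t) = arr F X Z (compose X g f) t"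
proof -
  have "arr F X Z (compose X g f) = compose (obj F X) (arr F Y Z g) (arr F X Y f)"
    using assms unfolding is_functor_def by blast
  with assms(7) show ?thesis
    by (simp add: compose_eq)
qed

lemma natural_transformation_app:
  assumes "natural_transformation F G \<alpha>" "small X" "small Y" "f \<in> X \<rightarrow>\<^sub>E Y" "t \<in> obj F X"
  shows "\<alpha> Y (arr F X Y f t) = arr G X Y f (\<alpha> X t)"
proof -
  have "compose (obj F X) (\<alpha> Y) (arr F X Y f) = compose (obj F X) (arr G X Y f) (\<alpha> X)"
    using assms unfolding natural_transformation_def by blast
  then have "compose (obj F X) (\<alpha> Y) (arr F X Y f) t = compose (obj F X) (arr G X Y f) (\<alpha> X) t"
    by simp
  with assms(5) show ?thesis
    by (simp add: compose_eq)
qed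

context
  fixes F :: "'u::set_universe endofunctor" and X :: "'u set"
  assumes F: "is_functor F" and X: "small X"
begin

lemma arr_proj1: "arr F (prd X X) X (proj1 X X) \<in> obj F (prd X X) \<rightarrow>\<^sub>E obj F X"
  by (intro functor_arr F small_prd X proj1_funcset)

lemma arr_proj2: "arr F (prd X X) X (proj2 X X) \<in> obj F (prd X X) \<rightarrow>\<^sub>E obj F X"
  by (intro functor_arr F small_prd X proj2_funcset)

lemma lam_funcset: "lam F X \<in> obj F (prd X X) \<rightarrow>\<^sub>E prd (obj F X) (obj F X)"
  using arr_proj1 arr_proj2 by (auto simp: lam_def intro!: pair_in_prd)

text \<open>Both sides are extensional on \<open>obj F (prd X X)\<close>, so comparing values there
  suffices. The equation is between arrows rather than between values because a further functor has
  to be applied to both sides of it.\<close>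

lemma compose_proj1_lam:
  "compose (obj F (prd X X)) (proj1 (obj F X) (obj F X)) (lam F X) = arr F (prd X X) X (proj1 X X)"
  using arr_proj1 arr_proj2
  by (intro extensionalityI[where A = "obj F (prd X X)"])
    (auto simp: compose_eq lam_def proj1_pair PiE_mem PiE_iff)

lemma compose_proj2_lam:
  "compose (obj F (prd X X)) (proj2 (obj F X) (obj F X)) (lam F X) = arr F (prd X X) X (proj2 X X)"
  using arr_proj1 arr_proj2
  by (intro extensionalityI[where A = "obj F (prd X X)"])
    (auto simp: compose_eq lam_def proj2_pair PiE_mem PiE_iff)

text \<open>Every member of \<open>prd\<close> is a pair, hence determined by \<open>pfst\<close>
  and \<open>psnd\<close>; the two marginal conditions on \<open>t\<close> therefore amount to the
  single condition \<open>lam F X t = z\<close>, and both joins range over the same set.\<close>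

lemma wasserstein_eq_direct_image:
  "wasserstein F Fh X r =
     direct_image (obj F (prd X X)) (prd (obj F X) (obj F X)) (lam F X) (Fh (prd X X) r)"
proof -
  have "{Fh (prd X X) r t | t. t \<in> obj F (prd X X) \<and>
               arr F (prd X X) X (proj1 X X) t = pfst z \<and>
               arr F (prd X X) X (proj2 X X) t = psnd z} =
        {Fh (prd X X) r t | t. t \<in> obj F (prd X X) \<and> lam F X t = z}"
    if "z \<in> prd (obj F X) (obj F X)" for z
    using that by (fastforce simp: lam_def prd_def)
  then show ?thesis
    unfolding wasserstein_def direct_image_def by (intro restrict_ext) simp
qed

end

lemma direct_image_in_preds: "direct_image X Y f p \<in> preds Y"
  by (simp add: direct_image_def preds_def)

text \<open>The value \<open>p x\<close> is itself among those joined at \<open>f x\<close>. Pushing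
  a predicate forward thus turns any arrow into a morphism of predicates, to which a lifting can be
  applied.\<close>

lemma pred_mor_direct_image:
  assumes "f \<in> X \<rightarrow>\<^sub>E Y"
  shows "pred_mor X p Y (direct_image X Y f p) f"
  using assms by (auto simp: pred_mor_def direct_image_def PiE_mem intro!: Sup_upper)

lemma wasserstein_leI:
  assumes "z \<in> prd (obj F X) (obj F X)"
    and "\<And>t. t \<in> obj F (prd X X) \<Longrightarrow> arr F (prd X X) X (proj1 X X) t = pfst z \<Longrightarrow>
           arr F (prd X X) X (proj2 X X) t = psnd z \<Longrightarrow> Fh (prd X X) r t \<le> c"
  shows "wasserstein F Fh X r z \<le> c"
  using assms by (auto simp: wasserstein_def intro!: Sup_least)

lemma wasserstein_ge:
  assumes "z \<in> prd (obj F X) (obj F X)" and "t \<in> obj F (prd X X)"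
    and "arr F (prd X X) X (proj1 X X) t = pfst z" and "arr F (prd X X) X (proj2 X X) t = psnd z"
  shows "Fh (prd X X) r t \<le> wasserstein F Fh X r z"
  using assms by (auto simp: wasserstein_def intro!: Sup_upper)

text \<open>Functoriality of \<open>F\<close> merges \<open>h\<close> and \<open>m\<close> into
  \<open>F (T f)\<close>, naturality moves this past \<open>\<zeta>\<close> as
  \<open>T (F f)\<close>, and functoriality of \<open>T\<close> splits it into \<open>g\<close> and
  \<open>l\<close>. The arrows stay abstract so that one proof serves both projections.\<close>

lemma transported_marginal:
  assumes F: "is_functor F" and T: "is_functor T"
    and nat: "natural_transformation (T \<circ>\<^sub>F F) (F \<circ>\<^sub>F T) \<zeta>"
    and sm: "small P" "small A" "small B" "small X"
    and f: "f \<in> P \<rightarrow>\<^sub>E X"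
    and l: "l \<in> obj F P \<rightarrow>\<^sub>E A" and g: "g \<in> A \<rightarrow>\<^sub>E obj F X"
    and gl: "compose (obj F P) g l = arr F P X f"
    and m: "m \<in> obj T P \<rightarrow>\<^sub>E B" and h: "h \<in> B \<rightarrow>\<^sub>E obj T X"
    and hm: "compose (obj T P) h m = arr T P X f"
    and w: "w \<in> obj T (obj F P)"
  shows "arr F B (obj T X) h (arr F (obj T P) B m (\<zeta> P w))
       = \<zeta> X (arr T A (obj F X) g (arr T (obj F P) A l w))"
proof -
  note small = sm functor_small[OF F] functor_small[OF T]
  have "\<zeta> P \<in> obj T (obj F P) \<rightarrow>\<^sub>E obj F (obj T P)"
    using nat sm by (simp add: natural_transformation_def comp_functor_def)
  then have "\<zeta> P w \<in> obj F (obj T P)"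
    using w by (rule PiE_mem)
  then have "arr F B (obj T X) h (arr F (obj T P) B m (\<zeta> P w))
      = arr F (obj T P) (obj T X) (arr T P X f) (\<zeta> P w)"
    using functor_arr_comp[OF F _ _ _ m h] hm small by simp
  also have "\<dots> = \<zeta> X (arr T (obj F P) (obj F X) (arr F P X f) w)"
    using natural_transformation_app[OF nat _ _ f] w sm by (simp add: comp_functor_def)
  also have "\<dots> = \<zeta> X (arr T A (obj F X) g (arr T (obj F P) A l w))"
    using functor_arr_comp[OF T _ _ _ l g w] gl small by simp
  finally show ?thesis .
qed

theorem theorem27:
  fixes F T :: "'u::set_universe endofunctor"
    and \<zeta> :: "'u set \<Rightarrow> 'u \<Rightarrow> 'u"
    and Fh Th :: "'u set \<Rightarrow> ('u \<Rightarrow> 'v::comm_quantale) \<Rightarrow> 'u \<Rightarrow> 'v"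
  assumes "is_functor F" and "is_functor T"
    and "natural_transformation (T \<circ>\<^sub>F F) (F \<circ>\<^sub>F T) \<zeta>"
    and "pred_lifting F Fh" and "pred_lifting T Th"
    and "lifts_to_pred F T Fh Th \<zeta>"
    and "\<And>X p t. small X \<Longrightarrow> p \<in> preds (obj F (prd X X)) \<Longrightarrow>
           t \<in> obj T (prd (obj F X) (obj F X)) \<Longrightarrow>
           Th (prd (obj F X) (obj F X))
              (direct_image (obj F (prd X X)) (prd (obj F X) (obj F X)) (lam F X) p) t
           \<le> direct_image (obj T (obj F (prd X X))) (obj T (prd (obj F X) (obj F X)))
               (arr T (obj F (prd X X)) (prd (obj F X) (obj F X)) (lam F X))
               (Th (obj F (prd X X)) p) t"
  shows "lifts_to_rel F T (wasserstein F Fh) (wasserstein T Th) \<zeta>"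
  unfolding lifts_to_rel_def rel_mor_def
proof (intro allI impI ballI conjI)
  note F = assms(1) and T = assms(2) and nat = assms(3)
  fix X :: "'u set" and r :: "'u \<Rightarrow> 'v"
  assume X: "small X" and r: "r \<in> rels X"
  let ?P = "prd X X" and ?A = "prd (obj F X) (obj F X)" and ?B = "prd (obj T X) (obj T X)"
  have FX: "small (obj F X)" and TX: "small (obj T X)"
    using F T X by (auto intro: functor_small)
  have sm: "small ?P" "small ?A" "small ?B"
    using X FX TX by (auto intro: small_prd)
  have FP: "small (obj F ?P)" and TP: "small (obj T ?P)"
    using F T sm by (auto intro: functor_small)
  have r': "r \<in> preds ?P"
    using r by (simp add: rels_def)
  have Fhr: "Fh ?P r \<in> preds (obj F ?P)" and Thr: "Th ?P r \<in> preds (obj T ?P)"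
    using assms(4,5) sm r' by (auto simp: pred_lifting_def)
  show \<zeta>: "\<zeta> X \<in> obj T (obj F X) \<rightarrow>\<^sub>E obj F (obj T X)"
    using nat X by (simp add: natural_transformation_def comp_functor_def)
  have \<zeta>P: "pred_mor (obj T (obj F ?P)) (Th (obj F ?P) (Fh ?P r))
      (obj F (obj T ?P)) (Fh (obj T ?P) (Th ?P r)) (\<zeta> ?P)"
    using assms(6) sm r' by (simp add: lifts_to_pred_def)
  \<comment> \<open>The arrow \<open>lam T X\<close> is a morphism from \<open>Th ?P r\<close> to
    its direct image, which is the Wasserstein lifting of \<open>r\<close>; the lifting
    \<open>Fh\<close> preserves this morphism.\<close>
  have Fm: "pred_mor (obj F (obj T ?P)) (Fh (obj T ?P) (Th ?P r))
      (obj F ?B) (Fh ?B (wasserstein T Th X r)) (arr F (obj T ?P) ?B (lam T X))"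
    using assms(4) TP sm Thr direct_image_in_preds pred_mor_direct_image[OF lam_funcset[OF T X]]
    unfolding pred_lifting_def wasserstein_eq_direct_image[OF T X] by blast
  fix u u'
  assume u: "u \<in> obj T (obj F X)" and u': "u' \<in> obj T (obj F X)"
  let ?c = "wasserstein F Fh (obj T X) (wasserstein T Th X r) (pair (\<zeta> X u) (\<zeta> X u'))"
  have below: "Th (obj F ?P) (Fh ?P r) w \<le> ?c"
    if w: "w \<in> obj T (obj F ?P)"
      and 1: "arr T ?A (obj F X) (proj1 (obj F X) (obj F X)) (arr T (obj F ?P) ?A (lam F X) w) = u"
      and 2: "arr T ?A (obj F X) (proj2 (obj F X) (obj F X)) (arr T (obj F ?P) ?A (lam F X) w) = u'"
    for w
  proof -
    let ?v = "arr F (obj T ?P) ?B (lam T X) (\<zeta> ?P w)"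
    have \<zeta>w: "\<zeta> ?P w \<in> obj F (obj T ?P)"
      using \<zeta>P w by (auto simp: pred_mor_def)
    have "Th (obj F ?P) (Fh ?P r) w \<le> Fh (obj T ?P) (Th ?P r) (\<zeta> ?P w)"
      using \<zeta>P w by (simp add: pred_mor_def)
    also have "\<dots> \<le> Fh ?B (wasserstein T Th X r) ?v"
      using Fm \<zeta>w by (simp add: pred_mor_def)
    \<comment> \<open>It suffices that \<open>?v\<close> is a coupling of \<open>\<zeta> X u\<close>
      and \<open>\<zeta> X u'\<close>, since \<open>?c\<close> is the join over all of
      these.\<close>
    also have "\<dots> \<le> ?c"
    proof (rule wasserstein_ge)
      show "pair (\<zeta> X u) (\<zeta> X u') \<in> prd (obj F (obj T X)) (obj F (obj T X))"
        using \<zeta> u u' by (auto intro!: pair_in_prd)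
      show "?v \<in> obj F ?B"
        using Fm \<zeta>w by (auto simp: pred_mor_def)
      \<comment> \<open>The premises left open concern the projection: \<open>f\<close> from
        \<open>?P\<close>, then \<open>g\<close> from \<open>?A\<close> and \<open>h\<close> from
        \<open>?B\<close>, the latter two each with its equation.\<close>
      note marginal = transported_marginal[OF F T nat sm X _ lam_funcset[OF F X] _ _
          lam_funcset[OF T X] _ _ w]
      show "arr F ?B (obj T X) (proj1 (obj T X) (obj T X)) ?v = pfst (pair (\<zeta> X u) (\<zeta> X u'))"
        using marginal[OF proj1_funcset proj1_funcset compose_proj1_lam[OF F X] proj1_funcset
            compose_proj1_lam[OF T X]] 1 by simp
      show "arr F ?B (obj T X) (proj2 (obj T X) (obj T X)) ?v = psnd (pair (\<zeta> X u) (\<zeta> X u'))"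
        using marginal[OF proj2_funcset proj2_funcset compose_proj2_lam[OF F X] proj2_funcset
            compose_proj2_lam[OF T X]] 2 by simp
    qed
    finally show ?thesis .
  qed
  show "wasserstein T Th (obj F X) (wasserstein F Fh X r) (pair u u') \<le> ?c"
  proof (rule wasserstein_leI)
    show "pair u u' \<in> prd (obj T (obj F X)) (obj T (obj F X))"
      using u u' by (rule pair_in_prd)
    fix s
    assume s: "s \<in> obj T ?A"
      and 1: "arr T ?A (obj F X) (proj1 (obj F X) (obj F X)) s = pfst (pair u u')"
      and 2: "arr T ?A (obj F X) (proj2 (obj F X) (obj F X)) s = psnd (pair u u')"
    have "Th ?A (wasserstein F Fh X r) s
        \<le> direct_image (obj T (obj F ?P)) (obj T ?A) (arr T (obj F ?P) ?A (lam F X))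
            (Th (obj F ?P) (Fh ?P r)) s"
      \<comment> \<open>The hypothesis on \<open>Th\<close> is applied to the predicate
        \<open>Fh ?P r\<close>.\<close>
      unfolding wasserstein_eq_direct_image[OF F X] using X Fhr s by (rule assms(7))
    also have "\<dots> \<le> ?c"
    proof -
      \<comment> \<open>Each \<open>w\<close> joined here is mapped to \<open>s\<close>, so it
        inherits the marginals \<open>u\<close> and \<open>u'\<close> of \<open>s\<close>, as
        \<open>below\<close> requires.\<close>
      have "y \<le> ?c" if "y \<in> {Th (obj F ?P) (Fh ?P r) w | w. w \<in> obj T (obj F ?P) \<and>
          arr T (obj F ?P) ?A (lam F X) w = s}" for y
        using that 1 2 below by fastforce
      then show ?thesis
        using s by (simp add: direct_image_def Sup_le_iff)
    qed
    finally show "Th ?A (wasserstein F Fh X r) s \<le> ?c" .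
  qed
qed

end
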